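(* Let $T_n(x)=\sum_{k=0}^{n-1}|c_n(k)|x^k$ for $n\ge 1$. (i) For every odd $n\ge 1$, $T_{2n}(x)=(1+x^n)T_n(x)$. (ii) For every odd $n\ge 1$ and every $k\ge 1$, $T_{2^kn}(x)=2^{k-1}\big(1+x^{2^{k-1}n}\big)T_n\big(x^{2^{k-1}}\big)$. (iii) For every even $n$, $1+x^{n/2}$ divides $T_n(x)$ in $\mathbb{Z}[x]$.
   Context: For integers $n\ge 1$ and $k$, the Ramanujan sum $c_n(k)$ is the sum of the $k$th powers of the primitive $n$th roots of unity, i.e. $c_n(k)=\sum_{1\le j\le n,\ \gcd(j,n)=1} e^{2\pi \sqrt{-1}\, jk/n}$. *)

theory Defs
  imports Complex_Main "HOL-Computational_Algebra.Polynomial"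
begin

definition ramanujan_sum :: "nat \<Rightarrow> int \<Rightarrow> complex" where
  "ramanujan_sum n k =
     (\<Sum>j | j \<in> {1..n} \<and> coprime j n.
        exp (2 * of_real pi * \<i> * of_nat j * of_int k / of_nat n))"

text \<open>The coefficients are the absolute values of complex numbers, so the polynomial is
  first of all a real one; that its coefficients are integers is a (standard) fact, not part of
  the definition.\<close>

definition ramanujan_abs_poly :: "nat \<Rightarrow> real poly" where
  "ramanujan_abs_poly n = (\<Sum>k<n. monom (cmod (ramanujan_sum n (int k))) k)"

end

theory Submission
  imports Defs
begin

text \<open>Shifting \<open>k\<close> by \<open>n/2\<close> for even \<open>n\<close> multiplies every primitive root of unity by \<open>-1\<close>
  (all \<open>j\<close> coprime to \<open>n\<close> are odd), so \<open>|c\<^sub>n|\<close> has period \<open>n/2\<close>; this yields the factor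
  \<open>1 + x\<^bsup>n/2\<^esup>\<close>. For odd \<open>n\<close> the substitution \<open>j \<mapsto> 2j + n\<close> gives \<open>c\<^sub>2\<^sub>n(k) = (-1)\<^sup>k c\<^sub>n(k)\<close>,
  and for even \<open>m\<close> pairing \<open>j\<close> with \<open>j + m\<close> gives \<open>c\<^sub>2\<^sub>m(k) = (1 + (-1)\<^sup>k) c\<^sub>m(k/2)\<close>, that is,
  \<open>T\<^sub>2\<^sub>m(x) = 2 T\<^sub>m(x\<^sup>2)\<close>. The sums \<open>c\<^sub>n(k)\<close> are integers by strong induction on \<open>n\<close>, since
  \<open>\<Sum>\<^bsub>d | n\<^esub> c\<^sub>d(k)\<close> is a complete geometric sum over the \<open>n\<close>-th roots of unity.\<close>

section \<open>Half-period and doubling identities for Ramanujan sums\<close>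

lemma ramanujan_sum_cis:
  "ramanujan_sum n k =
     (\<Sum>j | j \<in> {1..n} \<and> coprime j n. cis (2 * pi * real j * real_of_int k / real n))"
  unfolding ramanujan_sum_def
  by (intro sum.cong refl) (simp add: cis_conv_exp mult_ac)

lemma cis_pi_int: "cis (pi * real_of_int k) = (-1) powi k"
  by (metis cis_pi cis_power_int mult.commute)

lemma cis_pi_odd: "odd j \<Longrightarrow> cis (pi * real j) = -1" for j :: nat
  by (metis Complex.DeMoivre cis_pi mult.commute neg_one_odd_power)

lemma ramanujan_sum_half_period:
  assumes "even n" "n \<ge> 1"
  shows "ramanujan_sum n (k + int (n div 2)) = - ramanujan_sum n k"
proof -
  have half: "real_of_int (int (n div 2)) = real n / 2"
    using assms by (auto elim: evenE)
  have "cis (2 * pi * real j * real_of_int (k + int (n div 2)) / real n) =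
      - cis (2 * pi * real j * real_of_int k / real n)" if "coprime j n" for j
  proof -
    from that \<open>even n\<close> have "odd j"
      using coprime_common_divisor by fastforce
    have "2 * pi * real j * real_of_int (k + int (n div 2)) / real n =
        2 * pi * real j * real_of_int k / real n + pi * real j"
      using assms(2) unfolding of_int_add half by (simp add: field_simps)
    thus ?thesis
      using cis_pi_odd[OF \<open>odd j\<close>] by (simp add: cis_mult[symmetric])
  qed
  thus ?thesis
    unfolding ramanujan_sum_cis sum_negf[symmetric] by (intro sum.cong) auto
qed

lemma ramanujan_sum_double_odd:
  assumes "odd n"
  shows "ramanujan_sum (2 * n) k = (-1) powi k * ramanujan_sum n k"
proof -
  have n: "n \<ge> 1" using assms by (auto elim: oddE)
  \<comment> \<open>\<open>h i\<close> is \<open>2 * i + n\<close> reduced modulo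
    \<open>2 * n\<close> into \<open>{1..2*n}\<close>; equality \<open>2 * i = n\<close> cannot
    occur since \<open>n\<close> is odd. The first branch gives values above \<open>n\<close>, the
    second values at most \<open>n\<close> when \<open>i \<le> n\<close>, so the inverse
    \<open>g\<close> can branch on \<open>n < j\<close>.\<close>
  define h where "h i = (if 2 * i < n then 2 * i + n else 2 * i - n)" for i
  define g where "g j = (if n < j then (j - n) div 2 else (j + n) div 2)" for j
  have odd_h: "odd (h i)" for i
    using assms by (auto simp: h_def)
  have coprime_h: "coprime (h i) (2 * n) \<longleftrightarrow> coprime i n" for i
  proof -
    have two: "coprime 2 n" using assms by simp
    have "coprime (h i) n \<longleftrightarrow> coprime (2 * i) n"
    proof (cases "2 * i < n")
      case False
      hence "2 * i = h i + n" by (simp add: h_def)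
      thus ?thesis by (simp only: coprime_iff_gcd_eq_1 gcd_add1)
    qed (simp add: h_def coprime_iff_gcd_eq_1)
    thus ?thesis
      using odd_h[of i] two by simp
  qed
  have h_g: "h (g j) = j" if "odd j" "j \<le> 2 * n" for j
    using that assms by (auto simp: h_def g_def elim!: oddE) arith
  have "(\<Sum>i | i \<in> {1..n} \<and> coprime i n.
        (-1) powi k * cis (2 * pi * real i * real_of_int k / real n)) =
     (\<Sum>j | j \<in> {1..2*n} \<and> coprime j (2*n). cis (2 * pi * real j * real_of_int k / real (2*n)))"
  proof (rule sum.reindex_bij_witness[where i = g and j = h])
    fix i assume i: "i \<in> {i. i \<in> {1..n} \<and> coprime i n}"
    show "g (h i) = i"
      using i assms unfolding g_def h_def by auto
    have "1 \<le> h i" using odd_h[of i] by (simp add: Suc_le_eq odd_pos)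
    moreover have "h i \<le> 2 * n" using i by (auto simp: h_def)
    ultimately show "h i \<in> {j. j \<in> {1..2*n} \<and> coprime j (2*n)}"
      using i coprime_h[of i] by simp
    show "cis (2 * pi * real (h i) * real_of_int k / real (2*n)) =
       (-1) powi k * cis (2 * pi * real i * real_of_int k / real n)"
    proof (cases "2 * i < n")
      case True
      have "2 * pi * real (h i) * real_of_int k / real (2*n) =
          pi * real_of_int k + 2 * pi * real i * real_of_int k / real n"
        using True n by (simp add: h_def field_simps)
      thus ?thesis by (simp add: cis_mult[symmetric] cis_pi_int)
    next
      case False
      \<comment> \<open>Subtracting \<open>n\<close> instead of adding it turns the phase by
        \<open>- pi * k\<close>, which gives the same sign because
        \<open>(-1) powi (-k) = (-1) powi k\<close>.\<close>
      have "2 * pi * real (h i) * real_of_int k / real (2*n) =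
          pi * real_of_int (- k) + 2 * pi * real i * real_of_int k / real n"
        using False n by (simp add: h_def of_nat_diff field_simps)
      thus ?thesis
        by (simp only: cis_mult[symmetric] cis_pi_int power_int_minus_one_minus)
    qed
  next
    fix j assume j: "j \<in> {j. j \<in> {1..2*n} \<and> coprime j (2*n)}"
    hence "odd j" using coprime_common_divisor[of j "2*n" 2] by auto
    show "h (g j) = j" using \<open>odd j\<close> j by (intro h_g) auto
    have "g j \<in> {1..n}"
      using j assms n \<open>odd j\<close> by (auto simp: g_def elim!: oddE)
    thus "g j \<in> {i. i \<in> {1..n} \<and> coprime i n}"
      using j coprime_h[of "g j"] h_g[OF \<open>odd j\<close>] by auto
  qed
  thus ?thesis
    by (simp add: ramanujan_sum_cis sum_distrib_left)
qed

lemma ramanujan_sum_double_even: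
  assumes "even m" "m \<ge> 1"
  shows "ramanujan_sum (2 * m) k = (if even k then 2 * ramanujan_sum m (k div 2) else 0)"
proof -
  define f where "f j = cis (2 * pi * real j * real_of_int k / real (2 * m))" for j
  have split: "{j. j \<in> {1..2*m} \<and> coprime j (2*m)} =
      {j. j \<in> {1..m} \<and> coprime j m} \<union> (\<lambda>j. j + m) ` {j. j \<in> {1..m} \<and> coprime j m}"
    (is "?L = ?A \<union> ?B")
  proof -
    \<comment> \<open>For even \<open>m\<close> the numbers \<open>2 * m\<close> and
      \<open>m\<close> have the same prime factors, so coprimality to \<open>2 * m\<close> is
      periodic modulo \<open>m\<close>.\<close>
    have cop2: "coprime j (2 * m) \<longleftrightarrow> coprime j m" for j
      using \<open>even m\<close> by (auto elim!: evenE)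
    have "j \<in> ?A \<union> ?B" if "j \<in> ?L" for j
    proof (cases "j \<le> m")
      case False
      hence j: "j = (j - m) + m" by simp
      hence "coprime ((j - m) + m) m" using that by (simp add: cop2)
      hence "coprime (j - m) m" by (simp only: coprime_iff_gcd_eq_1 gcd_add1)
      with False that have "j - m \<in> ?A" by auto
      with j show ?thesis by blast
    qed (use that in \<open>simp add: cop2\<close>)
    moreover have "?A \<union> ?B \<subseteq> ?L"
      unfolding cop2 by (auto simp: coprime_iff_gcd_eq_1)
    ultimately show ?thesis by blast
  qed
  have shift: "f (j + m) = (-1) powi k * f j" for j
  proof -
    have "2 * pi * real (j + m) * real_of_int k / real (2 * m) =
        pi * real_of_int k + 2 * pi * real j * real_of_int k / real (2 * m)"
      using assms(2) by (simp add: field_simps)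
    thus ?thesis by (simp add: f_def cis_mult[symmetric] cis_pi_int)
  qed
  have "ramanujan_sum (2 * m) k = (\<Sum>j | j \<in> {1..m} \<and> coprime j m. f j) +
    (\<Sum>j | j \<in> {1..m} \<and> coprime j m. f (j + m))"
    unfolding ramanujan_sum_cis split f_def[symmetric]
    by (subst sum.union_disjoint) (auto simp: sum.reindex)
  also have "\<dots> = (1 + (-1) powi k) * (\<Sum>j | j \<in> {1..m} \<and> coprime j m. f j)"
    by (simp add: shift sum_distrib_left distrib_right sum.distrib)
  \<comment> \<open>The factor \<open>1 + (-1) powi k\<close> is 2 or 0. For even \<open>k\<close>,
    \<open>k / (2 * m) = (k div 2) / m\<close>, so the sum of \<open>f\<close> is the Ramanujan sum
    of \<open>m\<close> at \<open>k div 2\<close>.\<close>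
  finally show ?thesis
    unfolding f_def ramanujan_sum_cis
    by (auto simp: mult_ac elim!: evenE)
qed

section \<open>Integrality of Ramanujan sums\<close>

lemma sum_divisors_ramanujan_sum:
  assumes "n \<ge> 1"
  shows "(\<Sum>d | d dvd n. ramanujan_sum d k) =
    (\<Sum>j=1..n. cis (2 * pi * real j * real_of_int k / real n))"
proof -
  define e where "e j = cis (2 * pi * real j * real_of_int k / real n)" for j
  \<comment> \<open>In lowest terms the fraction \<open>j / n\<close> has denominator
    \<open>n div gcd j n\<close>. The indices with denominator \<open>d\<close> are the multiples
    \<open>i * c\<close> with \<open>c = n / d\<close> and \<open>i\<close> coprime to
    \<open>d\<close>.\<close>
  have "ramanujan_sum d k = (\<Sum>j | j \<in> {1..n} \<and> n div gcd j n = d. e j)" if "d dvd n" for d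
  proof -
    from that obtain c where n: "n = d * c" by blast
    have pos: "c > 0" "d > 0" using n assms by auto
    show ?thesis
      unfolding ramanujan_sum_cis
    proof (rule sum.reindex_bij_witness[where i = "\<lambda>j. j div c" and j = "\<lambda>i. i * c"])
      fix i assume i: "i \<in> {i. i \<in> {1..d} \<and> coprime i d}"
      show "i * c div c = i" using pos by simp
      have "gcd (i * c) n = c"
        using i by (simp add: n gcd_mult_distrib_nat[symmetric] mult.commute[of _ c] coprime_iff_gcd_eq_1)
      thus "i * c \<in> {j. j \<in> {1..n} \<and> n div gcd j n = d}"
        using i pos by (auto simp: n)
      show "e (i * c) = cis (2 * pi * real i * real_of_int k / real d)"
        using pos by (simp add: e_def n mult_ac)
    next
      fix j assume j: "j \<in> {j. j \<in> {1..n} \<and> n div gcd j n = d}"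
      have "n = d * gcd j n" using j by auto
      hence g: "gcd j n = c" using n pos by simp
      then obtain i where i: "j = i * c" by (metis dvd_div_mult_self gcd_dvd1)
      show "j div c * c = j" using i pos by simp
      have "c * gcd i d = c" using g by (simp add: n i gcd_mult_distrib_nat mult.commute[of _ c])
      thus "j div c \<in> {i. i \<in> {1..d} \<and> coprime i d}"
        using j i pos by (auto simp: n coprime_iff_gcd_eq_1)
    qed
  qed
  hence "(\<Sum>d | d dvd n. ramanujan_sum d k) =
      (\<Sum>d | d dvd n. \<Sum>j | j \<in> {1..n} \<and> n div gcd j n = d. e j)"
    by simp
  also have "\<dots> = (\<Sum>j=1..n. e j)"
    using assms by (intro sum.group) (auto intro: div_dvd_iff_mult[THEN iffD2])
  finally show ?thesis by (simp add: e_def)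
qed

text \<open>The sum runs over the powers of \<open>w\<close> with \<open>w ^ n = 1\<close>: it is
  \<open>n\<close> if \<open>w = 1\<close>, and otherwise the geometric sum formula gives 0.\<close>

lemma root_of_unity_sum_Ints:
  assumes "n \<ge> 1"
  shows "(\<Sum>j=1..n. cis (2 * pi * real j * real_of_int k / real n)) \<in> \<int>"
proof -
  define w where "w = cis (2 * pi * real_of_int k / real n)"
  have "w ^ n = cis (2 * pi * real_of_int k)"
    using assms by (simp add: w_def Complex.DeMoivre)
  hence wn: "w ^ n = 1" by (simp add: cis_multiple_2pi)
  have "(\<Sum>j=1..n. cis (2 * pi * real j * real_of_int k / real n)) = (\<Sum>j=1..n. w ^ j)"
    by (intro sum.cong) (simp_all add: w_def Complex.DeMoivre mult_ac)
  also have "\<dots> \<in> \<int>"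
  proof (cases "w = 1")
    case False
    have "(\<Sum>j=1..n. w ^ j) = w * (\<Sum>j<n. w ^ j)"
      by (simp add: sum_distrib_left sum.atLeast1_atMost_eq)
    also have "\<dots> = 0" using False wn by (simp add: geometric_sum)
    finally show ?thesis by simp
  qed simp
  finally show ?thesis .
qed

lemma ramanujan_sum_Ints:
  assumes "n \<ge> 1"
  shows "ramanujan_sum n k \<in> \<int>"
  using assms
proof (induction n rule: less_induct)
  case (less n)
  have fin: "finite {d. d dvd n}" using less.prems by simp
  \<comment> \<open>With the divisor \<open>n\<close> isolated, only proper divisors remain, to
    which the induction hypothesis applies.\<close>
  have "ramanujan_sum n k = (\<Sum>d | d dvd n. ramanujan_sum d k) -
      (\<Sum>d \<in> {d. d dvd n} - {n}. ramanujan_sum d k)"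
    by (subst sum.remove[OF fin, of n]) auto
  moreover have "(\<Sum>d \<in> {d. d dvd n} - {n}. ramanujan_sum d k) \<in> \<int>"
    using less by (intro Ints_sum less.IH)
      (auto dest: dvd_imp_le intro: Suc_leI dvd_pos_nat simp: le_neq_implies_less)
  ultimately show ?case
    using root_of_unity_sum_Ints[OF less.prems] sum_divisors_ramanujan_sum[OF less.prems] by simp
qed

section \<open>Factorisations of the polynomials\<close>

text \<open>Shifting the argument by half the index \<open>2 * n\<close> only changes a sign, which
  \<open>cmod\<close> removes, so the upper half of the coefficients repeats the lower half. Both
  the odd doubling formula and the integral divisibility rest on this.\<close>

lemma ramanujan_abs_poly_even:
  assumes "n \<ge> 1"
  shows "ramanujan_abs_poly (2 * n) =
     (1 + monom 1 n) * (\<Sum>k<n. monom (cmod (ramanujan_sum (2 * n) (int k))) k)"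
proof -
  have "ramanujan_abs_poly (2 * n) = (\<Sum>k<n. monom (cmod (ramanujan_sum (2 * n) (int k))) k) +
      (\<Sum>k=n..<2*n. monom (cmod (ramanujan_sum (2 * n) (int k))) k)"
    unfolding ramanujan_abs_poly_def lessThan_atLeast0
    by (subst sum.atLeastLessThan_concat) auto
  also have "(\<Sum>k=n..<2*n. monom (cmod (ramanujan_sum (2 * n) (int k))) k) =
      (\<Sum>k<n. monom (cmod (ramanujan_sum (2 * n) (int k + int n))) (n + k))"
    using sum.shift_bounds_nat_ivl[of "\<lambda>k. monom (cmod (ramanujan_sum (2 * n) (int k))) k" 0 n n]
    by (simp add: lessThan_atLeast0 mult_2 add_ac)
  also have "\<dots> = monom 1 n * (\<Sum>k<n. monom (cmod (ramanujan_sum (2 * n) (int k))) k)"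
    using ramanujan_sum_half_period[of "2 * n"] assms by (simp add: sum_distrib_left mult_monom)
  finally show ?thesis by (simp add: distrib_right)
qed

lemma ramanujan_abs_poly_double_odd:
  assumes "odd n"
  shows "ramanujan_abs_poly (2 * n) = (1 + monom 1 n) * ramanujan_abs_poly n"
proof -
  have "cmod (ramanujan_sum (2 * n) k) = cmod (ramanujan_sum n k)" for k
    by (simp add: ramanujan_sum_double_odd[OF assms] norm_mult norm_power_int)
  thus ?thesis
    using ramanujan_abs_poly_even[of n] assms
    by (simp add: ramanujan_abs_poly_def Suc_le_eq odd_pos)
qed

lemma pcompose_monom: "pcompose (monom a k) (monom 1 r) = monom a (r * k)"
  for a :: "'a :: comm_ring_1"
  by (induction k) (simp_all add: monom_Suc pcompose_pCons mult_monom monom_0)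

lemma smult_sum_right: "smult c (sum f A) = (\<Sum>x\<in>A. smult c (f x))"
  by (induction A rule: infinite_finite_induct) (simp_all add: smult_add_right)

lemma ramanujan_abs_poly_double_even:
  assumes "even m" "m \<ge> 1"
  shows "ramanujan_abs_poly (2 * m) = smult 2 (pcompose (ramanujan_abs_poly m) (monom 1 2))"
proof -
  \<comment> \<open>Only even exponents survive, since the sums for \<open>2 * m\<close> vanish at
    odd arguments.\<close>
  have "ramanujan_abs_poly (2 * m) =
     (\<Sum>k \<in> (\<lambda>i. 2 * i) ` {..<m}. monom (cmod (ramanujan_sum (2 * m) (int k))) k)"
    unfolding ramanujan_abs_poly_def
    by (intro sum.mono_neutral_right)
      (auto simp: ramanujan_sum_double_even[OF assms] image_iff elim!: evenE)
  also have "\<dots> = (\<Sum>i<m. smult 2 (monom (cmod (ramanujan_sum m (int i))) (2 * i)))"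
    by (simp add: sum.reindex inj_on_def ramanujan_sum_double_even[OF assms] norm_mult smult_monom)
  finally show ?thesis
    by (simp add: ramanujan_abs_poly_def pcompose_sum pcompose_monom smult_sum_right)
qed

text \<open>The first doubling starts from an odd index and creates the factor
  \<open>1 + monom 1 n\<close>; every later one starts from an even index, so it substitutes the
  square of the variable and contributes a factor 2.\<close>

lemma ramanujan_abs_poly_power2:
  assumes "odd n"
  shows "ramanujan_abs_poly (2 ^ Suc k * n) =
    smult (2 ^ k) ((1 + monom 1 (2 ^ k * n)) * pcompose (ramanujan_abs_poly n) (monom 1 (2 ^ k)))"
proof (induction k)
  case 0
  have "pcompose p (monom 1 1) = p" for p :: "real poly"
    by (metis monom_Suc monom_0 One_nat_def pcompose_idR)
  thus ?case by (simp add: ramanujan_abs_poly_double_odd assms)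
next
  case (Suc k)
  have "n \<ge> 1" using assms by (auto elim: oddE)
  hence "ramanujan_abs_poly (2 ^ Suc (Suc k) * n) =
     smult 2 (pcompose (ramanujan_abs_poly (2 ^ Suc k * n)) (monom 1 2))"
    using ramanujan_abs_poly_double_even[of "2 ^ Suc k * n"] by (simp add: mult_ac)
  also have "\<dots> = smult (2 ^ Suc k) ((1 + monom 1 (2 ^ Suc k * n)) *
      pcompose (ramanujan_abs_poly n) (monom 1 (2 ^ Suc k)))"
    unfolding Suc.IH
    by (simp add: pcompose_smult pcompose_mult pcompose_add pcompose_1 pcompose_monom
        pcompose_assoc[symmetric] mult_ac)
  finally show ?case .
qed

lemma map_poly_of_int_one_plus_monom_mult:
  "map_poly of_int ((1 + monom 1 h) * R) = (1 + monom 1 h) * (map_poly of_int R :: real poly)"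
  by (rule poly_eqI) (simp add: coeff_map_poly distrib_right coeff_monom_mult)

text \<open>The cofactor, formed by the lower half of the coefficients, is itself integral, so the
  divisibility holds over the integers and not merely over the reals.\<close>

lemma ramanujan_abs_poly_even_dvd:
  assumes "even n" "n \<ge> 1"
  shows "\<exists>P :: int poly. map_poly of_int P = ramanujan_abs_poly n \<and> (1 + monom 1 (n div 2)) dvd P"
proof -
  obtain h where n: "n = 2 * h" using \<open>even n\<close> by blast
  \<comment> \<open>The floor only changes the type from real to integer: the absolute values are
    already integers.\<close>
  define R where "R = (\<Sum>k<h. monom \<lfloor>cmod (ramanujan_sum n (int k))\<rfloor> k)"
  have "cmod (ramanujan_sum n k) \<in> \<int>" for k
    using ramanujan_sum_Ints[OF \<open>n \<ge> 1\<close>, of k] by (auto elim!: Ints_cases)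
  hence "map_poly of_int R = (\<Sum>k<h. monom (cmod (ramanujan_sum n (int k))) k)"
    unfolding R_def by (intro poly_eqI) (simp add: coeff_map_poly coeff_sum if_distrib cong: if_cong)
  hence "map_poly of_int ((1 + monom 1 h) * R) = ramanujan_abs_poly n"
    using ramanujan_abs_poly_even[of h] assms n by (simp add: map_poly_of_int_one_plus_monom_mult)
  thus ?thesis using n by (intro exI[of _ "(1 + monom 1 h) * R"]) simp
qed

theorem theorem14:
  shows "(\<forall>n\<ge>1. odd n \<longrightarrow>
           ramanujan_abs_poly (2 * n) = (1 + monom 1 n) * ramanujan_abs_poly n) \<and>
         (\<forall>n\<ge>1. odd n \<longrightarrow> (\<forall>k\<ge>1.
           ramanujan_abs_poly (2 ^ k * n) =
             smult (2 ^ (k - 1)) ((1 + monom 1 (2 ^ (k - 1) * n)) *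
               pcompose (ramanujan_abs_poly n) (monom 1 (2 ^ (k - 1)))))) \<and>
         (\<forall>n\<ge>1. even n \<longrightarrow>
           (\<exists>P :: int poly. map_poly of_int P = ramanujan_abs_poly n \<and>
              (1 + monom 1 (n div 2)) dvd P))"
proof (intro conjI allI impI)
  fix n k :: nat
  assume "odd n" "k \<ge> 1"
  thus "ramanujan_abs_poly (2 ^ k * n) = smult (2 ^ (k - 1)) ((1 + monom 1 (2 ^ (k - 1) * n)) *
          pcompose (ramanujan_abs_poly n) (monom 1 (2 ^ (k - 1))))"
    using ramanujan_abs_poly_power2[of n "k - 1"] by (cases k) auto
qed (use ramanujan_abs_poly_double_odd ramanujan_abs_poly_even_dvd in auto)

end
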